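(* Let $G$ be a topological group and let $X$ be a $G$-space. The family $\bar U_G$ is a uniformity on $X$ compatible with the topology of $X$ if and only if the action has the following property: for any $x\in X$ and any open neighbourhood $O$ of the identity in $G$ there exists $y\in X$ such that $x\in\mathrm{int}\,\mathrm{cl}(Oy)$.
   Context: All spaces are Tychonoff. A $G$-space is a Tychonoff space $X$ with a continuous action $G\times X\to X$ of the topological group $G$. Uniformities are described by coverings: a uniformity on $X$ is a family $U$ of coverings of $X$ such that (1) if $\gamma\in U$ refines a covering $\beta$ then $\beta\in U$; (2) any two members of $U$ have a common refinement in $U$; (3) every member of $U$ has a star refinement in $U$; (4) for distinct $x,y\in X$ some $\gamma\in U$ has no element containing both $x$ and $y$. The induced topology: $W$ is open iff for each $x\in W$ there is $\gamma\in U$ with $\mathrm{st}(x,\gamma)=\bigcup\{E\in\gamma: x\in E\}\subset W$. $U$ is compatible with the topology of $X$ if the induced topology equals the topology of $X$. For an open neighbourhood $O$ of the identity in $G$ put $\bar\gamma_O=\{\mathrm{cl}(Ox): x\in X\}$, where $Ox=\{gx: g\in O\}$. $\bar U_G$ is the family of all coverings of $X$ which have a refinement of the form $\bar\gamma_O$, with $O$ an open neighbourhood of the identity. Closure and interior are taken in $X$. *)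

theory Defs
  imports "HOL-Analysis.Analysis" "HOL-Algebra.Group_Action"
begin

definition tychonoff_space :: "'a topology \<Rightarrow> bool" where
  "tychonoff_space X \<longleftrightarrow> completely_regular_space X \<and> Hausdorff_space X"


subsection \<open>Topological groups and G-spaces\<close>

text \<open>All spaces, including the one underlying a topological group, are Tychonoff.\<close>

locale topological_group = group G
  for G (structure) and T :: "'g topology" +
  assumes topspace_eq_carrier: "topspace T = carrier G"
    and tychonoff_group: "tychonoff_space T"
    and continuous_mult: "continuous_map (prod_topology T T) T (\<lambda>(g, h). g \<otimes> h)"
    and continuous_inv: "continuous_map T T (\<lambda>g. inv g)"

text \<open>The library's \<^locale>\<open>group_action\<close> takes each \<open>\<phi> g\<close> to be a bijection of the phase
  space that is \<open>undefined\<close> off it; this only normalises irrelevant values.\<close>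

locale G_space = topological_group G T + group_action G "topspace X" \<phi>
  for G (structure) and T :: "'g topology" and X :: "'x topology" and \<phi> :: "'g \<Rightarrow> 'x \<Rightarrow> 'x" +
  assumes tychonoff_phase_space: "tychonoff_space X"
    and continuous_action: "continuous_map (prod_topology T X) X (\<lambda>(g, x). \<phi> g x)"

definition id_nbhd :: "('g, 'm) monoid_scheme \<Rightarrow> 'g topology \<Rightarrow> 'g set \<Rightarrow> bool" where
  "id_nbhd G T N \<longleftrightarrow> openin T N \<and> \<one>\<^bsub>G\<^esub> \<in> N"

definition translate :: "('g \<Rightarrow> 'x \<Rightarrow> 'x) \<Rightarrow> 'g set \<Rightarrow> 'x \<Rightarrow> 'x set" where
  "translate \<phi> N x = (\<lambda>g. \<phi> g x) ` N"


subsection \<open>Uniformities described by coverings\<close>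

definition covering :: "'x set \<Rightarrow> 'x set set \<Rightarrow> bool" where
  "covering S \<gamma> \<longleftrightarrow> \<Union>\<gamma> = S"

definition refinement :: "'x set set \<Rightarrow> 'x set set \<Rightarrow> bool" where
  "refinement \<gamma> \<beta> \<longleftrightarrow> (\<forall>E\<in>\<gamma>. \<exists>F\<in>\<beta>. E \<subseteq> F)"

definition star_of_set :: "'x set \<Rightarrow> 'x set set \<Rightarrow> 'x set" where
  "star_of_set A \<gamma> = \<Union>{E \<in> \<gamma>. E \<inter> A \<noteq> {}}"

definition star_of_point :: "'x \<Rightarrow> 'x set set \<Rightarrow> 'x set" where
  "star_of_point x \<gamma> = \<Union>{E \<in> \<gamma>. x \<in> E}"

definition star_refinement :: "'x set set \<Rightarrow> 'x set set \<Rightarrow> bool" where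
  "star_refinement \<gamma> \<beta> \<longleftrightarrow> refinement ((\<lambda>E. star_of_set E \<gamma>) ` \<gamma>) \<beta>"

definition covering_uniformity :: "'x set \<Rightarrow> 'x set set set \<Rightarrow> bool" where
  "covering_uniformity S U \<longleftrightarrow>
     (\<forall>\<gamma>\<in>U. covering S \<gamma>) \<and>
     (\<forall>\<gamma>\<in>U. \<forall>\<beta>. covering S \<beta> \<and> refinement \<gamma> \<beta> \<longrightarrow> \<beta> \<in> U) \<and>
     (\<forall>\<gamma>\<in>U. \<forall>\<beta>\<in>U. \<exists>\<delta>\<in>U. refinement \<delta> \<gamma> \<and> refinement \<delta> \<beta>) \<and>
     (\<forall>\<gamma>\<in>U. \<exists>\<delta>\<in>U. star_refinement \<delta> \<gamma>) \<and>
     (\<forall>x\<in>S. \<forall>y\<in>S. x \<noteq> y \<longrightarrow> (\<exists>\<gamma>\<in>U. \<not> (\<exists>E\<in>\<gamma>. x \<in> E \<and> y \<in> E)))"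

definition uniform_open :: "'x set \<Rightarrow> 'x set set set \<Rightarrow> 'x set \<Rightarrow> bool" where
  "uniform_open S U W \<longleftrightarrow> W \<subseteq> S \<and> (\<forall>x\<in>W. \<exists>\<gamma>\<in>U. star_of_point x \<gamma> \<subseteq> W)"

text \<open>The induced topology is given by its open sets, since for an arbitrary family \<open>U\<close>
  they need not form a topology.\<close>

definition compatible_uniformity :: "'x topology \<Rightarrow> 'x set set set \<Rightarrow> bool" where
  "compatible_uniformity X U \<longleftrightarrow> (\<forall>W. uniform_open (topspace X) U W \<longleftrightarrow> openin X W)"


subsection \<open>The family of coverings determined by the action\<close>

definition closed_orbit_cover ::
  "'x topology \<Rightarrow> ('g \<Rightarrow> 'x \<Rightarrow> 'x) \<Rightarrow> 'g set \<Rightarrow> 'x set set" where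
  "closed_orbit_cover X \<phi> N = (\<lambda>x. X closure_of (translate \<phi> N x)) ` topspace X"

definition closed_orbit_uniformity ::
  "('g, 'm) monoid_scheme \<Rightarrow> 'g topology \<Rightarrow> 'x topology \<Rightarrow> ('g \<Rightarrow> 'x \<Rightarrow> 'x) \<Rightarrow> 'x set set set" where
  "closed_orbit_uniformity G T X \<phi> =
     {\<beta>. covering (topspace X) \<beta> \<and>
         (\<exists>N. id_nbhd G T N \<and> refinement (closed_orbit_cover X \<phi> N) \<beta>)}"

end

theory Submission
  imports Defs
begin

text \<open>
  Continuity of the action at the identity and regularity of \<open>X\<close> make the stars of the coverings
  \<open>{cl (N x)}\<close> arbitrarily small, whatever the action; so the stated property is only needed to
  make these stars neighbourhoods and to get star refinements. For the latter, let \<open>V\<close> be symmetric, let \<open>p\<close> lie in both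
  \<open>cl (V x)\<close> and \<open>cl (V y)\<close>, and choose \<open>q\<close> and \<open>z\<close> with \<open>p \<in> int cl (V q)\<close> and
  \<open>x \<in> int cl (V z)\<close>, where \<open>z\<close> does not depend on \<open>y\<close>. Density of \<open>V x\<close> and \<open>V y\<close> near \<open>p\<close>
  gives \<open>x, y \<in> cl (V\<^sup>2 q)\<close>, and density of \<open>V\<^sup>2 q\<close> near \<open>x\<close> gives \<open>q \<in> cl (V\<^sup>3 z)\<close>. Hence
  \<open>cl (V y) \<subseteq> cl (V\<^sup>6 z)\<close>.
\<close>

section \<open>Stars and refinements in an arbitrary covering uniformity\<close>

lemma refinement_trans:
  assumes "refinement \<alpha> \<beta>" "refinement \<beta> \<gamma>"
  shows "refinement \<alpha> \<gamma>"
  unfolding refinement_def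
proof
  fix E assume "E \<in> \<alpha>"
  then obtain F where "F \<in> \<beta>" "E \<subseteq> F"
    using assms(1) by (auto simp: refinement_def)
  moreover from this(1) obtain H where "H \<in> \<gamma>" "F \<subseteq> H"
    using assms(2) by (auto simp: refinement_def)
  ultimately show "\<exists>H\<in>\<gamma>. E \<subseteq> H"
    by blast
qed

lemma covering_uniformity_star_refinement:
  assumes "covering_uniformity S U" "\<gamma> \<in> U"
  obtains \<delta> where "\<delta> \<in> U" "star_refinement \<delta> \<gamma>"
proof -
  have "\<forall>\<gamma>\<in>U. \<exists>\<delta>\<in>U. star_refinement \<delta> \<gamma>"
    using assms(1) unfolding covering_uniformity_def by (elim conjE)
  then show thesis
    using assms(2) that by blast
qed

text \<open>Stars of points are neighbourhoods in the induced topology, although a single star need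
  not be open. The witness consists of the points that have a whole star, with respect to some
  member of \<open>U\<close>, inside \<open>star_of_point x \<gamma>\<close>; this is the interior
  of that star, and axiom (3) makes it open.\<close>

lemma covering_uniformity_star_nbhd:
  assumes "covering_uniformity S U" "\<gamma> \<in> U" "x \<in> S"
  obtains W where "uniform_open S U W" "x \<in> W" "W \<subseteq> star_of_point x \<gamma>"
proof
  let ?W = "{z \<in> S. \<exists>\<epsilon>\<in>U. star_of_point z \<epsilon> \<subseteq> star_of_point x \<gamma>}"
  have cover: "\<Union>\<epsilon> = S" if "\<epsilon> \<in> U" for \<epsilon>
    using assms(1) that by (auto simp: covering_uniformity_def covering_def)
  show "x \<in> ?W"
    using assms(2,3) by auto
  have "z \<in> star_of_point z \<epsilon>" if "z \<in> S" "\<epsilon> \<in> U" for z \<epsilon>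
    using cover[OF that(2)] that(1) by (auto simp: star_of_point_def)
  then show "?W \<subseteq> star_of_point x \<gamma>"
    by blast
  show "uniform_open S U ?W"
    unfolding uniform_open_def
  proof (intro conjI ballI)
    show "?W \<subseteq> S"
      by (rule Collect_restrict)
    fix z assume "z \<in> ?W"
    then obtain \<epsilon> where \<epsilon>: "\<epsilon> \<in> U" "star_of_point z \<epsilon> \<subseteq> star_of_point x \<gamma>"
      by blast
    \<comment> \<open>If \<open>E\<close> in \<open>\<delta>\<close> contains both \<open>z\<close>
      and \<open>w\<close>, then the star of \<open>w\<close> lies in the star of \<open>E\<close>,
      hence in one \<open>F\<close> of \<open>\<epsilon>\<close>. As \<open>F\<close> contains
      \<open>z\<close>, it lies in the star of \<open>z\<close> for \<open>\<epsilon>\<close>, so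
      \<open>\<delta>\<close> itself shows that \<open>w\<close> belongs to the candidate
      set.\<close>
    obtain \<delta> where \<delta>: "\<delta> \<in> U" "star_refinement \<delta> \<epsilon>"
      using covering_uniformity_star_refinement[OF assms(1) \<epsilon>(1)] .
    have "w \<in> ?W" if w: "w \<in> star_of_point z \<delta>" for w
    proof -
      obtain E where E: "E \<in> \<delta>" "z \<in> E" "w \<in> E"
        using w by (auto simp: star_of_point_def)
      obtain F where F: "F \<in> \<epsilon>" "star_of_set E \<delta> \<subseteq> F"
        using \<delta>(2) E(1) by (auto simp: star_refinement_def refinement_def)
      have "star_of_point w \<delta> \<subseteq> star_of_set E \<delta>"
        using E(3) by (auto simp: star_of_point_def star_of_set_def)
      moreover have "z \<in> F"
        using E F(2) by (auto simp: star_of_set_def)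
      then have "F \<subseteq> star_of_point z \<epsilon>"
        using F(1) by (auto simp: star_of_point_def)
      ultimately have "star_of_point w \<delta> \<subseteq> star_of_point x \<gamma>"
        using F(2) \<epsilon>(2) by blast
      then show ?thesis
        using \<delta>(1) cover[OF \<delta>(1)] E by blast
    qed
    then show "\<exists>\<delta>\<in>U. star_of_point z \<delta> \<subseteq> ?W"
      using \<delta>(1) by (intro bexI[of _ \<delta>] subsetI)
  qed
qed

section \<open>Small neighbourhoods of the identity\<close>

lemma openin_prod_topology_rectangle:
  assumes "openin (prod_topology X Y) S" "(x, y) \<in> S"
  obtains U V where "openin X U" "openin Y V" "x \<in> U" "y \<in> V" "U \<times> V \<subseteq> S"
proof -
  have "\<exists>U V. openin X U \<and> openin Y V \<and> x \<in> U \<and> y \<in> V \<and> U \<times> V \<subseteq> S"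
    using openin_prod_topology_alt[THEN iffD1, OF assms(1)] assms(2) by (elim allE impE)
  then show thesis
    using that by blast
qed

lemma (in topological_group) id_nbhd_subset_carrier: "id_nbhd G T N \<Longrightarrow> N \<subseteq> carrier G"
  using openin_subset topspace_eq_carrier by (auto simp: id_nbhd_def)

lemma (in topological_group) id_nbhd_Int:
  "id_nbhd G T M \<Longrightarrow> id_nbhd G T N \<Longrightarrow> id_nbhd G T (M \<inter> N)"
  by (auto simp: id_nbhd_def)

lemma (in topological_group) id_nbhd_symmetric:
  assumes "id_nbhd G T N"
  obtains V where "id_nbhd G T V" "V \<subseteq> N" "\<And>a. a \<in> V \<Longrightarrow> inv a \<in> V"
proof
  let ?I = "{a \<in> topspace T. inv a \<in> N}"
  have "openin T ?I"
    using assms continuous_inv by (auto simp: id_nbhd_def openin_continuous_map_preimage)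
  then show "id_nbhd G T (N \<inter> ?I)"
    using assms topspace_eq_carrier by (auto simp: id_nbhd_def)
  show "inv a \<in> N \<inter> ?I" if "a \<in> N \<inter> ?I" for a
    using that topspace_eq_carrier by auto
qed auto

text \<open>Continuity of multiplication at \<open>(\<one>, \<one>)\<close> gives a rectangle
  \<open>A \<times> B\<close> whose products fall into \<open>N\<close>; \<open>V\<close> is a
  symmetric neighbourhood inside \<open>A \<inter> B\<close>. The inclusion
  \<open>V \<subseteq> N\<close> comes from multiplying by \<open>\<one>\<close>, which lies in
  \<open>V\<close>.\<close>

lemma (in topological_group) id_nbhd_square:
  assumes "id_nbhd G T N"
  obtains V where "id_nbhd G T V" "V \<subseteq> N" "\<And>a. a \<in> V \<Longrightarrow> inv a \<in> V"
    "\<And>a b. a \<in> V \<Longrightarrow> b \<in> V \<Longrightarrow> a \<otimes> b \<in> N"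
proof -
  let ?P = "{p \<in> topspace (prod_topology T T). (case p of (g, h) \<Rightarrow> g \<otimes> h) \<in> N}"
  have "openin T N"
    using assms by (simp add: id_nbhd_def)
  with continuous_mult have "openin (prod_topology T T) ?P"
    by (rule openin_continuous_map_preimage)
  moreover have "(\<one>, \<one>) \<in> ?P"
    using assms topspace_eq_carrier by (auto simp: id_nbhd_def)
  ultimately obtain A B where AB: "openin T A" "openin T B" "\<one> \<in> A" "\<one> \<in> B" "A \<times> B \<subseteq> ?P"
    by (rule openin_prod_topology_rectangle)
  then have "id_nbhd G T (A \<inter> B)"
    by (auto simp: id_nbhd_def)
  then obtain V where V: "id_nbhd G T V" "V \<subseteq> A \<inter> B" "\<And>a. a \<in> V \<Longrightarrow> inv a \<in> V"
    using id_nbhd_symmetric by blast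
  have prod: "a \<otimes> b \<in> N" if "a \<in> V" "b \<in> V" for a b
    using that V(2) subsetD[OF AB(5), of "(a, b)"] by auto
  have "V \<subseteq> N"
  proof
    fix a assume a: "a \<in> V"
    then have "a \<otimes> \<one> \<in> N"
      using prod V(1) by (auto simp: id_nbhd_def)
    then show "a \<in> N"
      using a id_nbhd_subset_carrier[OF V(1)] by auto
  qed
  with that V prod show thesis
    by blast
qed

section \<open>Closures of translates under the action\<close>

context G_space
begin

lemma action_one: "x \<in> topspace X \<Longrightarrow> \<phi> \<one> x = x"
  using fun_cong[OF id_eq_one, of x] by simp

lemma continuous_map_action: "g \<in> carrier G \<Longrightarrow> continuous_map X X (\<phi> g)"
  using continuous_map_compose[OF _ continuous_action, of X "\<lambda>x. (g, x)"] topspace_eq_carrier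
  by (simp add: o_def continuous_map_pairwise)

text \<open>The continuous map \<open>\<phi> g\<close> sends the closure of \<open>B z\<close> into
  the closure of \<open>(g B) z\<close>. Products are compared elementwise with a set
  \<open>C\<close>, here and below, so that the neighbourhoods chosen later can be inserted directly
  without forming product sets.\<close>

lemma action_closure_of_translate:
  assumes "g \<in> carrier G" "x \<in> X closure_of (translate \<phi> B z)"
    and "B \<subseteq> carrier G" "z \<in> topspace X" "\<And>b. b \<in> B \<Longrightarrow> g \<otimes> b \<in> C"
  shows "\<phi> g x \<in> X closure_of (translate \<phi> C z)"
proof -
  have "\<phi> g x \<in> X closure_of (\<phi> g ` translate \<phi> B z)"
    using continuous_map_image_closure_subset[OF continuous_map_action[OF assms(1)]] assms(2)
    by blast
  moreover have "\<phi> g ` translate \<phi> B z \<subseteq> translate \<phi> C z"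
    unfolding translate_def image_image
  proof (rule image_subsetI)
    fix b assume b: "b \<in> B"
    have "\<phi> g (\<phi> b z) = \<phi> (g \<otimes> b) z"
      using composition_rule assms(1,3,4) b by auto
    then show "\<phi> g (\<phi> b z) \<in> (\<lambda>g. \<phi> g z) ` C"
      using assms(5)[OF b] by auto
  qed
  ultimately show ?thesis
    using closure_of_mono by blast
qed

text \<open>Every \<open>a\<close> in \<open>A\<close> carries \<open>y\<close> into the closed set
  \<open>cl (C z)\<close>, so this set contains \<open>A y\<close> and with it the closure of
  \<open>A y\<close>.\<close>

lemma closure_of_translate_trans:
  assumes "x \<in> X closure_of (translate \<phi> A y)" "y \<in> X closure_of (translate \<phi> B z)"
    and "A \<subseteq> carrier G" "B \<subseteq> carrier G" "z \<in> topspace X"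
    and "\<And>a b. a \<in> A \<Longrightarrow> b \<in> B \<Longrightarrow> a \<otimes> b \<in> C"
  shows "x \<in> X closure_of (translate \<phi> C z)"
proof -
  have "translate \<phi> A y \<subseteq> X closure_of (translate \<phi> C z)"
    using action_closure_of_translate[OF _ assms(2)] assms(3-6) by (auto simp: translate_def)
  then show ?thesis
    using closure_of_minimal[OF _ closedin_closure_of] assms(1) by blast
qed

text \<open>The interior of \<open>cl (B z)\<close> is an open set around \<open>x\<close>, so it
  meets \<open>A y\<close> in some point \<open>a y\<close>. Applying \<open>inv a\<close> returns
  this point to \<open>y\<close> and moves \<open>cl (B z)\<close> into \<open>cl (C z)\<close>.
  Mere membership of \<open>x\<close> in \<open>cl (B z)\<close> would not provide such an
  \<open>a\<close>.\<close>

lemma closure_of_translate_cancel: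
  assumes "x \<in> X closure_of (translate \<phi> A y)"
    and "x \<in> X interior_of (X closure_of (translate \<phi> B z))"
    and "A \<subseteq> carrier G" "B \<subseteq> carrier G" "y \<in> topspace X" "z \<in> topspace X"
    and "\<And>a b. a \<in> A \<Longrightarrow> b \<in> B \<Longrightarrow> inv a \<otimes> b \<in> C"
  shows "y \<in> X closure_of (translate \<phi> C z)"
proof -
  obtain v where "v \<in> translate \<phi> A y" "v \<in> X interior_of (X closure_of (translate \<phi> B z))"
    using assms(1,2) openin_interior_of[of X] unfolding in_closure_of by blast
  then obtain a where a: "a \<in> A" "\<phi> a y \<in> X interior_of (X closure_of (translate \<phi> B z))"
    by (auto simp: translate_def)
  from a(2) have "\<phi> a y \<in> X closure_of (translate \<phi> B z)"
    by (rule subsetD[OF interior_of_subset])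
  then have "\<phi> (inv a) (\<phi> a y) \<in> X closure_of (translate \<phi> C z)"
    by (rule action_closure_of_translate[rotated]) (use a(1) assms(3-7) in auto)
  moreover have "\<phi> (inv a) (\<phi> a y) = y"
    using orbit_sym_aux a(1) assms(3,5) by blast
  ultimately show ?thesis
    by simp
qed

section \<open>Coverings by closures of translates: small stars and star refinements\<close>

lemma translate_subset_topspace:
  "N \<subseteq> carrier G \<Longrightarrow> x \<in> topspace X \<Longrightarrow> translate \<phi> N x \<subseteq> topspace X"
  using element_image by (auto simp: translate_def)

lemma mem_closure_of_translate:
  assumes "id_nbhd G T N" "x \<in> topspace X"
  shows "x \<in> X closure_of (translate \<phi> N x)"
proof -
  have "x \<in> translate \<phi> N x"
    using assms action_one by (force simp: translate_def id_nbhd_def)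
  moreover have "translate \<phi> N x \<subseteq> X closure_of (translate \<phi> N x)"
    using assms by (intro closure_of_subset translate_subset_topspace id_nbhd_subset_carrier)
  ultimately show ?thesis
    by blast
qed

lemma covering_closed_orbit_cover:
  assumes "id_nbhd G T N"
  shows "covering (topspace X) (closed_orbit_cover X \<phi> N)"
  unfolding covering_def closed_orbit_cover_def
proof
  show "(\<Union>x\<in>topspace X. X closure_of (translate \<phi> N x)) \<subseteq> topspace X"
    by (intro UN_least closure_of_subset_topspace)
  show "topspace X \<subseteq> (\<Union>x\<in>topspace X. X closure_of (translate \<phi> N x))"
    using mem_closure_of_translate[OF assms] by auto
qed

lemma closed_orbit_cover_in_uniformity:
  "id_nbhd G T N \<Longrightarrow> closed_orbit_cover X \<phi> N \<in> closed_orbit_uniformity G T X \<phi>"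
  using covering_closed_orbit_cover by (auto simp: closed_orbit_uniformity_def refinement_def)

lemma closed_orbit_cover_mono:
  assumes "M \<subseteq> N"
  shows "refinement (closed_orbit_cover X \<phi> M) (closed_orbit_cover X \<phi> N)"
proof -
  have "X closure_of (translate \<phi> M x) \<subseteq> X closure_of (translate \<phi> N x)" for x
    using assms by (intro closure_of_mono) (auto simp: translate_def)
  then show ?thesis
    unfolding refinement_def closed_orbit_cover_def by blast
qed

text \<open>If \<open>x\<close> lies in \<open>cl (N y)\<close>, some \<open>a y\<close> is close to
  \<open>x\<close>. Every other point of \<open>N y\<close> is
  \<open>b y = (b \<otimes> inv a) (a y)\<close>, a small group element applied to a point near
  \<open>x\<close>, so it stays near \<open>x\<close> by continuity of the action at
  \<open>(\<one>, x)\<close>.\<close>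

lemma closed_orbit_star_small:
  assumes "openin X W" "x \<in> W"
  obtains N where "id_nbhd G T N" "star_of_point x (closed_orbit_cover X \<phi> N) \<subseteq> W"
proof -
  have x: "x \<in> topspace X"
    using assms openin_subset by blast
  have "regular_space X"
    using tychonoff_phase_space completely_regular_imp_regular_space
    by (auto simp: tychonoff_space_def)
  then have "neighbourhood_base_of (closedin X) X"
    by (simp add: neighbourhood_base_of_closedin)
  \<comment> \<open>The closed set \<open>C\<close> is there because the whole closure of
    \<open>N y\<close> must end up in \<open>W\<close>: it suffices to bring \<open>N y\<close> into
    \<open>U\<close>.\<close>
  then have "\<exists>U C. openin X U \<and> closedin X C \<and> x \<in> U \<and> U \<subseteq> C \<and> C \<subseteq> W"
    using assms by (simp add: neighbourhood_base_of)
  then obtain U C where UC: "openin X U" "closedin X C" "x \<in> U" "U \<subseteq> C" "C \<subseteq> W"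
    by blast
  let ?P = "{p \<in> topspace (prod_topology T X). (case p of (g, x) \<Rightarrow> \<phi> g x) \<in> U}"
  have "openin (prod_topology T X) ?P"
    using continuous_action UC(1) by (rule openin_continuous_map_preimage)
  moreover have "(\<one>, x) \<in> ?P"
    using x UC(3) topspace_eq_carrier action_one by simp
  ultimately obtain A B where
    AB: "openin T A" "openin X B" "\<one> \<in> A" "x \<in> B" "A \<times> B \<subseteq> ?P"
    by (rule openin_prod_topology_rectangle)
  have "id_nbhd G T A"
    using AB by (auto simp: id_nbhd_def)
  then obtain N where N: "id_nbhd G T N" "\<And>a. a \<in> N \<Longrightarrow> inv a \<in> N"
    "\<And>a b. a \<in> N \<Longrightarrow> b \<in> N \<Longrightarrow> a \<otimes> b \<in> A"
    using id_nbhd_square by metis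
  note sub = id_nbhd_subset_carrier[OF N(1)]
  have "X closure_of (translate \<phi> N y) \<subseteq> W"
    if y: "y \<in> topspace X" "x \<in> X closure_of (translate \<phi> N y)" for y
  proof -
    obtain a where a: "a \<in> N" "\<phi> a y \<in> B"
      using y(2) AB(2,4) by (auto simp: in_closure_of translate_def)
    have "\<phi> b y \<in> U" if b: "b \<in> N" for b
    proof -
      have "b \<otimes> inv a \<in> A"
        using N(2,3) a(1) b by blast
      then have "\<phi> (b \<otimes> inv a) (\<phi> a y) \<in> U"
        using subsetD[OF AB(5), of "(b \<otimes> inv a, \<phi> a y)"] a(2) by simp
      moreover have "\<phi> (b \<otimes> inv a) (\<phi> a y) = \<phi> b (\<phi> (inv a) (\<phi> a y))"
        using composition_rule element_image a(1) b sub y(1) by (meson inv_closed subsetD)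
      moreover have "\<phi> (inv a) (\<phi> a y) = y"
        using orbit_sym_aux a(1) sub y(1) by blast
      ultimately show ?thesis
        by simp
    qed
    then have "translate \<phi> N y \<subseteq> C"
      using UC(4) by (auto simp: translate_def)
    then show ?thesis
      using closure_of_minimal UC(2,5) by (meson subset_trans)
  qed
  then have "star_of_point x (closed_orbit_cover X \<phi> N) \<subseteq> W"
    by (auto simp: star_of_point_def closed_orbit_cover_def)
  with that N(1) show thesis
    by blast
qed

lemma closed_orbit_cover_star_refinement:
  assumes interior: "\<And>x N. x \<in> topspace X \<Longrightarrow> id_nbhd G T N \<Longrightarrow>
      \<exists>y\<in>topspace X. x \<in> X interior_of (X closure_of (translate \<phi> N y))"
    and N: "id_nbhd G T N"
  obtains V where "id_nbhd G T V"
    "star_refinement (closed_orbit_cover X \<phi> V) (closed_orbit_cover X \<phi> N)"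
proof -
  \<comment> \<open>Three halvings give \<open>V\<^sup>8 \<subseteq> N\<close>, which leaves room
    for the sixth power. The sets \<open>N2\<close>, \<open>N1\<close> and \<open>N\<close> take the
    places of \<open>V\<^sup>2\<close>, \<open>V\<^sup>3\<close> and
    \<open>V\<^sup>6\<close>.\<close>
  obtain N1 where N1: "id_nbhd G T N1" "\<And>a b. a \<in> N1 \<Longrightarrow> b \<in> N1 \<Longrightarrow> a \<otimes> b \<in> N"
    using id_nbhd_square[OF N] by metis
  obtain N2 where N2: "id_nbhd G T N2" "\<And>a. a \<in> N2 \<Longrightarrow> inv a \<in> N2"
    "\<And>a b. a \<in> N2 \<Longrightarrow> b \<in> N2 \<Longrightarrow> a \<otimes> b \<in> N1"
    using id_nbhd_square[OF N1(1)] by metis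
  obtain V where V: "id_nbhd G T V" "V \<subseteq> N2" "\<And>a. a \<in> V \<Longrightarrow> inv a \<in> V"
    "\<And>a b. a \<in> V \<Longrightarrow> b \<in> V \<Longrightarrow> a \<otimes> b \<in> N2"
    using id_nbhd_square[OF N2(1)] by metis
  note sub = id_nbhd_subset_carrier[OF N1(1)] id_nbhd_subset_carrier[OF N2(1)]
    id_nbhd_subset_carrier[OF V(1)]
  have "\<exists>F\<in>closed_orbit_cover X \<phi> N.
      star_of_set (X closure_of (translate \<phi> V x)) (closed_orbit_cover X \<phi> V) \<subseteq> F"
    if x: "x \<in> topspace X" for x
  proof -
    \<comment> \<open>The point \<open>z\<close> is fixed from \<open>x\<close> alone, so that the
      single element \<open>cl (N z)\<close> can hold the entire star of \<open>cl (V x)\<close>;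
      the later \<open>q\<close> may vary with \<open>p\<close>.\<close>
    obtain z where z: "z \<in> topspace X" "x \<in> X interior_of (X closure_of (translate \<phi> V z))"
      using interior[OF x V(1)] by blast
    have "u \<in> X closure_of (translate \<phi> N z)"
      if y: "y \<in> topspace X" and p: "p \<in> X closure_of (translate \<phi> V x)"
        "p \<in> X closure_of (translate \<phi> V y)" and u: "u \<in> X closure_of (translate \<phi> V y)"
      for y p u
    proof -
      have "p \<in> topspace X"
        using p(1) by (simp add: in_closure_of)
      then obtain q where q: "q \<in> topspace X" "p \<in> X interior_of (X closure_of (translate \<phi> V q))"
        using interior V(1) by blast
      have "x \<in> X closure_of (translate \<phi> N2 q)"
        by (rule closure_of_translate_cancel[OF p(1) q(2)]) (use sub x q V in auto)
      \<comment> \<open>The element cancelled here comes from \<open>N2\<close>, which is why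
        \<open>N2\<close> was chosen symmetric as well as \<open>V\<close>.\<close>
      then have qz: "q \<in> X closure_of (translate \<phi> N1 z)"
        by (rule closure_of_translate_cancel[OF _ z(2)]) (use sub z q V N2 in auto)
      have "y \<in> X closure_of (translate \<phi> N2 q)"
        by (rule closure_of_translate_cancel[OF p(2) q(2)]) (use sub y q V in auto)
      then have "u \<in> X closure_of (translate \<phi> N1 q)"
        by (rule closure_of_translate_trans[OF u]) (use sub q V N2 in auto)
      then show ?thesis
        by (rule closure_of_translate_trans[OF _ qz]) (use sub z N1 in auto)
    qed
    then have "star_of_set (X closure_of (translate \<phi> V x)) (closed_orbit_cover X \<phi> V)
        \<subseteq> X closure_of (translate \<phi> N z)"
      by (auto simp: star_of_set_def closed_orbit_cover_def)
    then show ?thesis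
      using z(1) by (auto simp: closed_orbit_cover_def)
  qed
  then have "star_refinement (closed_orbit_cover X \<phi> V) (closed_orbit_cover X \<phi> N)"
    by (auto simp: star_refinement_def refinement_def closed_orbit_cover_def)
  with that V(1) show thesis
    by blast
qed

section \<open>The interior property against being a compatible uniformity, in both
  directions\<close>

lemma covering_uniformity_closed_orbit:
  assumes "\<And>x N. x \<in> topspace X \<Longrightarrow> id_nbhd G T N \<Longrightarrow>
      \<exists>y\<in>topspace X. x \<in> X interior_of (X closure_of (translate \<phi> N y))"
  shows "covering_uniformity (topspace X) (closed_orbit_uniformity G T X \<phi>)"
    (is "covering_uniformity _ ?U")
  unfolding covering_uniformity_def
proof (intro conjI ballI allI impI)
  fix \<gamma> assume "\<gamma> \<in> ?U"
  then show "covering (topspace X) \<gamma>"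
    by (simp add: closed_orbit_uniformity_def)
next
  fix \<gamma> \<beta> assume "\<gamma> \<in> ?U" "covering (topspace X) \<beta> \<and> refinement \<gamma> \<beta>"
  then show "\<beta> \<in> ?U"
    using refinement_trans by (auto simp: closed_orbit_uniformity_def)
next
  fix \<gamma> \<beta> assume "\<gamma> \<in> ?U" "\<beta> \<in> ?U"
  then obtain M N where M: "id_nbhd G T M" "refinement (closed_orbit_cover X \<phi> M) \<gamma>"
    and N: "id_nbhd G T N" "refinement (closed_orbit_cover X \<phi> N) \<beta>"
    by (auto simp: closed_orbit_uniformity_def)
  have "refinement (closed_orbit_cover X \<phi> (M \<inter> N)) \<gamma>"
    using refinement_trans[OF closed_orbit_cover_mono M(2)] by simp
  moreover have "refinement (closed_orbit_cover X \<phi> (M \<inter> N)) \<beta>"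
    using refinement_trans[OF closed_orbit_cover_mono N(2)] by simp
  ultimately show "\<exists>\<delta>\<in>?U. refinement \<delta> \<gamma> \<and> refinement \<delta> \<beta>"
    using closed_orbit_cover_in_uniformity id_nbhd_Int M(1) N(1) by blast
next
  fix \<gamma> assume "\<gamma> \<in> ?U"
  then obtain N where N: "id_nbhd G T N" "refinement (closed_orbit_cover X \<phi> N) \<gamma>"
    by (auto simp: closed_orbit_uniformity_def)
  obtain V where "id_nbhd G T V"
    "star_refinement (closed_orbit_cover X \<phi> V) (closed_orbit_cover X \<phi> N)"
    using closed_orbit_cover_star_refinement[OF assms N(1)] by blast
  moreover from this(2) have "star_refinement (closed_orbit_cover X \<phi> V) \<gamma>"
    using refinement_trans N(2) by (auto simp: star_refinement_def)
  ultimately show "\<exists>\<delta>\<in>?U. star_refinement \<delta> \<gamma>"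
    using closed_orbit_cover_in_uniformity by blast
next
  fix x y assume xy: "x \<in> topspace X" "y \<in> topspace X" "x \<noteq> y"
  have "t1_space X"
    using tychonoff_phase_space Hausdorff_imp_t1_space by (auto simp: tychonoff_space_def)
  \<comment> \<open>A covering element containing both points would put \<open>y\<close> into the
    star of \<open>x\<close>, which is made to fit inside \<open>W\<close>.\<close>
  then obtain W where W: "openin X W" "x \<in> W" "y \<notin> W"
    using xy by (auto simp: t1_space_def)
  then obtain N where "id_nbhd G T N" "star_of_point x (closed_orbit_cover X \<phi> N) \<subseteq> W"
    using closed_orbit_star_small by blast
  then have "closed_orbit_cover X \<phi> N \<in> ?U"
      "\<not> (\<exists>E\<in>closed_orbit_cover X \<phi> N. x \<in> E \<and> y \<in> E)"
    using W(3) closed_orbit_cover_in_uniformity by (auto simp: star_of_point_def)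
  then show "\<exists>\<gamma>\<in>?U. \<not> (\<exists>E\<in>\<gamma>. x \<in> E \<and> y \<in> E)"
    by (rule bexI[rotated])
qed

lemma compatible_uniformity_closed_orbit:
  assumes "\<And>x N. x \<in> topspace X \<Longrightarrow> id_nbhd G T N \<Longrightarrow>
      \<exists>y\<in>topspace X. x \<in> X interior_of (X closure_of (translate \<phi> N y))"
  shows "compatible_uniformity X (closed_orbit_uniformity G T X \<phi>)"
    (is "compatible_uniformity X ?U")
  unfolding compatible_uniformity_def
proof (intro allI iffI)
  fix W assume W: "uniform_open (topspace X) ?U W"
  show "openin X W"
  proof (subst openin_subopen, intro ballI)
    fix x assume "x \<in> W"
    then obtain \<gamma> where \<gamma>: "\<gamma> \<in> ?U" "star_of_point x \<gamma> \<subseteq> W" and x: "x \<in> topspace X"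
      using W unfolding uniform_open_def by blast
    from \<gamma>(1) obtain N where N: "id_nbhd G T N" "refinement (closed_orbit_cover X \<phi> N) \<gamma>"
      by (auto simp: closed_orbit_uniformity_def)
    \<comment> \<open>The interior of this one \<open>cl (N y)\<close> is the required open set
      around \<open>x\<close>: the member \<open>F\<close> of \<open>\<gamma>\<close> that contains
      \<open>cl (N y)\<close> contains \<open>x\<close>, hence is part of the star of
      \<open>x\<close>.\<close>
    obtain y where y: "y \<in> topspace X" "x \<in> X interior_of (X closure_of (translate \<phi> N y))"
      using assms[OF x N(1)] by blast
    obtain F where "F \<in> \<gamma>" "X closure_of (translate \<phi> N y) \<subseteq> F"
      using N(2) y(1) by (auto simp: refinement_def closed_orbit_cover_def)
    then have "X interior_of (X closure_of (translate \<phi> N y)) \<subseteq> star_of_point x \<gamma>"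
      using y(2) interior_of_subset[of X] unfolding star_of_point_def by blast
    then show "\<exists>V. openin X V \<and> x \<in> V \<and> V \<subseteq> W"
      using y(2) \<gamma>(2) openin_interior_of by (metis subset_trans)
  qed
next
  fix W assume W: "openin X W"
  show "uniform_open (topspace X) ?U W"
    unfolding uniform_open_def
  proof (intro conjI ballI)
    show "W \<subseteq> topspace X"
      using W by (rule openin_subset)
    fix x assume "x \<in> W"
    with W obtain N where "id_nbhd G T N" "star_of_point x (closed_orbit_cover X \<phi> N) \<subseteq> W"
      by (rule closed_orbit_star_small)
    then show "\<exists>\<gamma>\<in>?U. star_of_point x \<gamma> \<subseteq> W"
      using closed_orbit_cover_in_uniformity by blast
  qed
qed

text \<open>The star of \<open>x\<close> for the covering given by \<open>N\<close> is a
  neighbourhood of \<open>x\<close>, but it may be a union of many sets \<open>cl (N y)\<close>.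
  Passing to a star refinement \<open>\<delta>\<close> puts the star of \<open>x\<close> inside a
  single \<open>cl (N y)\<close>; compatibility then turns the uniform neighbourhood
  \<open>W\<close> into an open set of \<open>X\<close>.\<close>

lemma interior_closure_of_translate_if_uniformity:
  assumes U: "covering_uniformity (topspace X) (closed_orbit_uniformity G T X \<phi>)"
      "compatible_uniformity X (closed_orbit_uniformity G T X \<phi>)"
    and x: "x \<in> topspace X" and N: "id_nbhd G T N"
  shows "\<exists>y\<in>topspace X. x \<in> X interior_of (X closure_of (translate \<phi> N y))"
proof -
  obtain \<delta> where \<delta>: "\<delta> \<in> closed_orbit_uniformity G T X \<phi>"
    "star_refinement \<delta> (closed_orbit_cover X \<phi> N)"
    using covering_uniformity_star_refinement[OF U(1) closed_orbit_cover_in_uniformity[OF N]] .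
  obtain W where "uniform_open (topspace X) (closed_orbit_uniformity G T X \<phi>) W"
    and W: "x \<in> W" "W \<subseteq> star_of_point x \<delta>"
    using covering_uniformity_star_nbhd[OF U(1) \<delta>(1) x] .
  then have "openin X W"
    using U(2) by (simp add: compatible_uniformity_def)
  obtain E where E: "E \<in> \<delta>" "x \<in> E"
    using W by (auto simp: star_of_point_def)
  obtain y where y: "y \<in> topspace X" "star_of_set E \<delta> \<subseteq> X closure_of (translate \<phi> N y)"
    using \<delta>(2) E(1) by (auto simp: star_refinement_def refinement_def closed_orbit_cover_def)
  have "star_of_point x \<delta> \<subseteq> star_of_set E \<delta>"
    using E(2) by (auto simp: star_of_point_def star_of_set_def)
  then have "W \<subseteq> X closure_of (translate \<phi> N y)"
    using W(2) y(2) by blast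
  then have "W \<subseteq> X interior_of (X closure_of (translate \<phi> N y))"
    using \<open>openin X W\<close> by (rule interior_of_maximal)
  then show ?thesis
    using y(1) W(1) by blast
qed

end

theorem theorem3:
  fixes G :: "('g, 'm) monoid_scheme" and T :: "'g topology"
    and X :: "'x topology" and \<phi> :: "'g \<Rightarrow> 'x \<Rightarrow> 'x"
  assumes "G_space G T X \<phi>"
  shows "covering_uniformity (topspace X) (closed_orbit_uniformity G T X \<phi>) \<and>
         compatible_uniformity X (closed_orbit_uniformity G T X \<phi>) \<longleftrightarrow>
         (\<forall>x\<in>topspace X. \<forall>N. id_nbhd G T N \<longrightarrow>
            (\<exists>y\<in>topspace X. x \<in> X interior_of (X closure_of (translate \<phi> N y))))"
proof -
  interpret G_space G T X \<phi>
    by (fact assms)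
  let ?U = "closed_orbit_uniformity G T X \<phi>"
  show ?thesis
  proof
    assume "covering_uniformity (topspace X) ?U \<and> compatible_uniformity X ?U"
    then show "\<forall>x\<in>topspace X. \<forall>N. id_nbhd G T N \<longrightarrow>
        (\<exists>y\<in>topspace X. x \<in> X interior_of (X closure_of (translate \<phi> N y)))"
      by (intro ballI allI impI interior_closure_of_translate_if_uniformity) auto
  next
    assume "\<forall>x\<in>topspace X. \<forall>N. id_nbhd G T N \<longrightarrow>
        (\<exists>y\<in>topspace X. x \<in> X interior_of (X closure_of (translate \<phi> N y)))"
    then have "\<And>x N. x \<in> topspace X \<Longrightarrow> id_nbhd G T N \<Longrightarrow>
        \<exists>y\<in>topspace X. x \<in> X interior_of (X closure_of (translate \<phi> N y))"
      by simp
    then show "covering_uniformity (topspace X) ?U \<and> compatible_uniformity X ?U"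
      by (intro conjI covering_uniformity_closed_orbit compatible_uniformity_closed_orbit)
  qed
qed

end
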